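(* Let $(X,d)$ be a proper geodesic Gromov hyperbolic metric space, let $f\colon X\to X$ be a non-expanding self-map, let $p\in X$, and let $\eta\in\partial_GX$ be a boundary regular fixed point of $f$. Then the sequence $(\log\lambda_{\eta,p}(f^n))_{n\ge1}$ is superadditive, i.e. for all $n,m\ge1$, $$\log\lambda_{\eta,p}(f^{n+m})\ge\log\lambda_{\eta,p}(f^n)+\log\lambda_{\eta,p}(f^m).$$
   Context: Non-expanding: $d(f(x),f(y))\le d(x,y)$. Gromov hyperbolic: for some $\delta>0$, in every geodesic triangle each side lies in the $\delta$-neighborhood of the union of the other two. $\partial_GX$ is the Gromov boundary; convergence to boundary points is in the Gromov compactification $\overline X^G$. For non-expanding $g$, the dilation is given by $\log\lambda_{\eta,p}(g)=\liminf_{z\to\eta}[d(z,p)-d(g(z),p)]$. Geodesic region: $\{x\in X: d(x,\gamma)<R\}$ for a geodesic ray $\gamma$ and $R>0$, with vertex $[\gamma]\in\partial_GX$. $g$ has geodesic limit $\xi$ at $\eta$ if $g(x_n)\to\xi$ for every sequence $x_n\to\eta$ contained in a geodesic region with vertex $\eta$. $\eta$ is a boundary regular fixed point (BRFP) of $g$ if $\lambda_{\eta,p}(g)<+\infty$ (independent of $p$) and $g$ has geodesic limit $\eta$ at $\eta$. A BRFP of $f$ is a BRFP of all iterates $f^n$, so all dilations above are finite. *)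

theory Defs
  imports "HOL-Analysis.Analysis"
begin

section \<open>Proper geodesic Gromov hyperbolic spaces\<close>

definition proper_space :: "'a::metric_space itself \<Rightarrow> bool" where
  "proper_space _ \<longleftrightarrow> (\<forall>(x::'a) r. compact (cball x r))"

definition geodesic_segment :: "'a::metric_space \<Rightarrow> 'a \<Rightarrow> 'a set \<Rightarrow> bool" where
  "geodesic_segment x y S \<longleftrightarrow>
     (\<exists>c::real \<Rightarrow> 'a. c 0 = x \<and> c (dist x y) = y \<and>
        (\<forall>s\<in>{0..dist x y}. \<forall>t\<in>{0..dist x y}. dist (c s) (c t) = \<bar>s - t\<bar>) \<and>
        S = c ` {0..dist x y})"

definition geodesic_space :: "'a::metric_space itself \<Rightarrow> bool" where
  "geodesic_space _ \<longleftrightarrow> (\<forall>(x::'a) y. \<exists>S. geodesic_segment x y S)"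

definition nbhd_of_set :: "'a::metric_space set \<Rightarrow> real \<Rightarrow> 'a set" where
  "nbhd_of_set S R = {x. infdist x S < R}"

text \<open>Since the triangle is arbitrary, it suffices to constrain one of its sides.\<close>

definition gromov_hyperbolic :: "'a::metric_space itself \<Rightarrow> bool" where
  "gromov_hyperbolic _ \<longleftrightarrow>
     (\<exists>\<delta>>0. \<forall>(x::'a) y z A B C.
        geodesic_segment x y A \<and> geodesic_segment y z B \<and> geodesic_segment z x C \<longrightarrow>
        A \<subseteq> nbhd_of_set (B \<union> C) \<delta>)"


section \<open>The Gromov boundary\<close>

text \<open>Only the restriction of a ray to \<open>{0..}\<close> matters; rays that agree there
  are identified by \<open>asymptotic_rays\<close>.\<close>

definition geodesic_ray :: "(real \<Rightarrow> 'a::metric_space) \<Rightarrow> bool" where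
  "geodesic_ray \<gamma> \<longleftrightarrow> (\<forall>s\<ge>0. \<forall>t\<ge>0. dist (\<gamma> s) (\<gamma> t) = \<bar>s - t\<bar>)"

definition asymptotic_rays :: "((real \<Rightarrow> 'a::metric_space) \<times> (real \<Rightarrow> 'a)) set" where
  "asymptotic_rays =
     {(\<gamma>, \<sigma>). geodesic_ray \<gamma> \<and> geodesic_ray \<sigma> \<and> (\<exists>C. \<forall>t\<ge>0. dist (\<gamma> t) (\<sigma> t) \<le> C)}"

definition gromov_boundary :: "(real \<Rightarrow> 'a::metric_space) set set" where
  "gromov_boundary = {\<gamma>. geodesic_ray \<gamma>} // asymptotic_rays"


section \<open>The Gromov compactification\<close>

definition gromov_product :: "'a::metric_space \<Rightarrow> 'a \<Rightarrow> 'a \<Rightarrow> real" where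
  "gromov_product p x y = (dist x p + dist y p - dist x y) / 2"

text \<open>A point of the disjoint union of the space and its boundary is represented by curves
  tending to it: a point \<open>x\<close> of the space by the constant curve, a boundary point by the
  geodesic rays in its class.\<close>

fun representatives :: "'a::metric_space + (real \<Rightarrow> 'a) set \<Rightarrow> (real \<Rightarrow> 'a) set" where
  "representatives (Inl x) = {\<lambda>_. x}"
| "representatives (Inr \<xi>) = \<xi>"

text \<open>The usual extension \<open>sup liminf (x\<^sub>i | y\<^sub>j)\<close> of the Gromov product to boundary points.\<close>

definition extended_gromov_product ::
    "'a::metric_space \<Rightarrow> 'a + (real \<Rightarrow> 'a) set \<Rightarrow> 'a + (real \<Rightarrow> 'a) set \<Rightarrow> ereal" where
  "extended_gromov_product p u v =
     (SUP c\<in>representatives u. SUP c'\<in>representatives v.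
        Liminf (at_top \<times>\<^sub>F at_top) (\<lambda>(s, t). ereal (gromov_product p (c s) (c' t))))"

definition gromov_points :: "('a::metric_space + (real \<Rightarrow> 'a) set) set" where
  "gromov_points = range Inl \<union> Inr ` gromov_boundary"

text \<open>The standard topology on the Gromov compactification: points of the space have their metric
  neighbourhoods, and the sets \<open>{u. (\<xi> | u)\<^sub>p > r}\<close> form a neighbourhood base at a boundary
  point \<open>\<xi>\<close>. Changing \<open>p\<close> changes Gromov products by a bounded amount, so quantifying over all
  \<open>p\<close> amounts to fixing one base point.\<close>

definition gromov_open :: "('a::metric_space + (real \<Rightarrow> 'a) set) set \<Rightarrow> bool" where
  "gromov_open U \<longleftrightarrow>
     U \<subseteq> gromov_points \<and> open (Inl -` U) \<and>
     (\<forall>\<xi>. Inr \<xi> \<in> U \<longrightarrow>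
        (\<forall>p. \<exists>r::real. {u \<in> gromov_points. extended_gromov_product p (Inr \<xi>) u > ereal r} \<subseteq> U))"

definition gromov_compactification :: "('a::metric_space + (real \<Rightarrow> 'a) set) topology" where
  "gromov_compactification = topology gromov_open"

lemma istopology_gromov_open: "istopology gromov_open"
  unfolding istopology_def
proof (intro conjI allI impI)
  fix S T :: "('a + (real \<Rightarrow> 'a) set) set"
  assume S: "gromov_open S" and T: "gromov_open T"
  show "gromov_open (S \<inter> T)"
    unfolding gromov_open_def
  proof (intro conjI allI impI)
    show "S \<inter> T \<subseteq> gromov_points" "open (Inl -` (S \<inter> T))"
      using S T by (auto simp: gromov_open_def)
    fix \<xi> p assume "Inr \<xi> \<in> S \<inter> T"
    then obtain r1 r2 where
      "{u \<in> gromov_points. extended_gromov_product p (Inr \<xi>) u > ereal r1} \<subseteq> S"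
      "{u \<in> gromov_points. extended_gromov_product p (Inr \<xi>) u > ereal r2} \<subseteq> T"
      using S T unfolding gromov_open_def by blast
    then have "{u \<in> gromov_points. extended_gromov_product p (Inr \<xi>) u > ereal (max r1 r2)}
        \<subseteq> S \<inter> T"
      by (fastforce intro: le_less_trans[of _ "ereal (max r1 r2)"])
    then show "\<exists>r::real. {u \<in> gromov_points. extended_gromov_product p (Inr \<xi>) u > ereal r}
        \<subseteq> S \<inter> T" ..
  qed
next
  fix K :: "('a + (real \<Rightarrow> 'a) set) set set"
  assume K: "\<forall>S\<in>K. gromov_open S"
  show "gromov_open (\<Union>K)"
    unfolding gromov_open_def
  proof (intro conjI allI impI)
    show "\<Union>K \<subseteq> gromov_points" "open (Inl -` \<Union>K)"
      using K by (auto simp: gromov_open_def vimage_Union)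
    fix \<xi> p assume "Inr \<xi> \<in> \<Union>K"
    then obtain S where S: "S \<in> K" "Inr \<xi> \<in> S" by blast
    then obtain r where "{u \<in> gromov_points. extended_gromov_product p (Inr \<xi>) u > ereal r} \<subseteq> S"
      using K unfolding gromov_open_def by blast
    with S show "\<exists>r::real. {u \<in> gromov_points. extended_gromov_product p (Inr \<xi>) u > ereal r}
        \<subseteq> \<Union>K"
      by blast
  qed
qed

lemma openin_gromov_compactification: "openin gromov_compactification U \<longleftrightarrow> gromov_open U"
  by (simp add: gromov_compactification_def istopology_gromov_open topology_inverse')

lemma topspace_gromov_compactification: "topspace gromov_compactification = gromov_points"
proof -
  have "gromov_open (gromov_points :: ('a + (real \<Rightarrow> 'a) set) set)"
    by (auto simp: gromov_open_def gromov_points_def vimage_def)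
  then show ?thesis
    unfolding topspace_def openin_gromov_compactification
    by (auto simp: gromov_open_def)
qed

definition converges_to_boundary ::
    "(nat \<Rightarrow> 'a::metric_space) \<Rightarrow> (real \<Rightarrow> 'a) set \<Rightarrow> bool" where
  "converges_to_boundary x \<xi> \<longleftrightarrow>
     limitin gromov_compactification (\<lambda>n. Inl (x n)) (Inr \<xi>) sequentially"

text \<open>The filter on the space of \<open>z \<rightarrow> \<xi>\<close> in the Gromov compactification.\<close>

definition at_boundary :: "(real \<Rightarrow> 'a::metric_space) set \<Rightarrow> 'a filter" where
  "at_boundary \<xi> = filtercomap Inl (nhdsin gromov_compactification (Inr \<xi>))"


section \<open>Dilation and boundary regular fixed points\<close>

definition log_dilation ::
    "(real \<Rightarrow> 'a::metric_space) set \<Rightarrow> 'a \<Rightarrow> ('a \<Rightarrow> 'a) \<Rightarrow> ereal" where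
  "log_dilation \<eta> p g = Liminf (at_boundary \<eta>) (\<lambda>z. ereal (dist z p - dist (g z) p))"

definition geodesic_region :: "(real \<Rightarrow> 'a::metric_space) \<Rightarrow> real \<Rightarrow> 'a set" where
  "geodesic_region \<gamma> R = nbhd_of_set (\<gamma> ` {0..}) R"

text \<open>As \<open>\<eta>\<close> is a class of rays, \<open>\<gamma> \<in> \<eta>\<close> says that \<open>\<gamma>\<close> is a ray with vertex \<open>\<eta>\<close>.\<close>

definition has_geodesic_limit ::
    "('a::metric_space \<Rightarrow> 'a) \<Rightarrow> (real \<Rightarrow> 'a) set \<Rightarrow> (real \<Rightarrow> 'a) set \<Rightarrow> bool" where
  "has_geodesic_limit g \<eta> \<xi> \<longleftrightarrow>
     (\<forall>x \<gamma> R. \<gamma> \<in> \<eta> \<and> R > 0 \<and> (\<forall>n. x n \<in> geodesic_region \<gamma> R) \<and> converges_to_boundary x \<eta>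
        \<longrightarrow> converges_to_boundary (\<lambda>n. g (x n)) \<xi>)"

text \<open>Finiteness of the dilation does not depend on the base point, since
  \<open>dist z p - dist (g z) p\<close> changes by at most \<open>2 * dist p q\<close> when \<open>p\<close> is replaced by \<open>q\<close>.\<close>

definition boundary_regular_fixed_point ::
    "('a::metric_space \<Rightarrow> 'a) \<Rightarrow> (real \<Rightarrow> 'a) set \<Rightarrow> bool" where
  "boundary_regular_fixed_point g \<eta> \<longleftrightarrow>
     \<eta> \<in> gromov_boundary \<and> (\<exists>p. log_dilation \<eta> p g < \<infinity>) \<and> has_geodesic_limit g \<eta> \<eta>"

end

theory Submission
  imports Defs
begin

text \<open>Write \<open>d(z,p) - d(f\<^sup>n\<^sup>+\<^sup>m z,p)\<close> as the sum of \<open>d(z,p) - d(f\<^sup>m z,p)\<close> and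
  \<open>d(f\<^sup>m z,p) - d(f\<^sup>n (f\<^sup>m z),p)\<close>. Superadditivity follows if \<open>f\<^sup>m z \<rightarrow> \<eta>\<close> whenever \<open>z \<rightarrow> \<eta>\<close>, and it
  suffices to know this where \<open>d(z,p) - d(f\<^sup>n\<^sup>+\<^sup>m z,p)\<close> is bounded above. There \<open>d(z,p) - d(f z,p)\<close> is
  bounded above as well, and since \<open>d(z,\<gamma> t)\<close> is about \<open>d(z,p) - t\<close> on a ray \<open>\<gamma>\<close> with vertex \<open>\<eta>\<close>,
  \<open>d(f z,f (\<gamma> t))\<close> is at most about \<open>d(f z,p) - t\<close>. Hence \<open>f z\<close> and \<open>f (\<gamma> t)\<close> have a large Gromov
  product, while \<open>f (\<gamma> t) \<rightarrow> \<eta>\<close> because \<open>\<eta>\<close> is the geodesic limit. Iterating this for \<open>f\<close> alone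
  avoids showing that the iterates have a geodesic limit too.\<close>

section \<open>The four-point inequality\<close>

lemma geodesic_segment_commute:
  assumes "geodesic_segment x y S"
  shows "geodesic_segment y x S"
proof -
  obtain c where c: "c 0 = x" "c (dist x y) = y" "S = c ` {0..dist x y}"
    and iso: "\<forall>s\<in>{0..dist x y}. \<forall>t\<in>{0..dist x y}. dist (c s) (c t) = \<bar>s - t\<bar>"
    using assms unfolding geodesic_segment_def by blast
  have "(\<lambda>t. dist x y - t) ` {0..dist x y} = {0..dist x y}"
    by simp
  then have "S = (\<lambda>t. c (dist x y - t)) ` {0..dist y x}"
    using c(3) by (metis dist_commute image_image)
  with c iso show ?thesis
    unfolding geodesic_segment_def
    by (intro exI[of _ "\<lambda>t. c (dist x y - t)"]) (auto simp: dist_commute)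
qed

lemma geodesic_segment_endpoints:
  assumes "geodesic_segment x y S"
  shows "x \<in> S" "y \<in> S"
proof -
  obtain c where "c 0 = x" "c (dist x y) = y" "S = c ` {0..dist x y}"
    using assms unfolding geodesic_segment_def by blast
  then show "x \<in> S" "y \<in> S"
    using imageI[of 0 "{0..dist x y}" c] imageI[of "dist x y" "{0..dist x y}" c] by auto
qed

lemma geodesic_segment_dist_add:
  assumes "geodesic_segment x y S" "w \<in> S"
  shows "dist x w + dist w y = dist x y"
proof -
  obtain c where c: "c 0 = x" "c (dist x y) = y" "S = c ` {0..dist x y}"
    and iso: "\<forall>s\<in>{0..dist x y}. \<forall>t\<in>{0..dist x y}. dist (c s) (c t) = \<bar>s - t\<bar>"
    using assms unfolding geodesic_segment_def by blast
  obtain t where t: "t \<in> {0..dist x y}" "w = c t"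
    using c(3) assms(2) by blast
  have "dist (c 0) (c t) = \<bar>0 - t\<bar>" "dist (c t) (c (dist x y)) = \<bar>t - dist x y\<bar>"
    using iso t(1) by auto
  with c t show ?thesis by auto
qed

text \<open>The infimum need not be attained, but a strict bound leaves room for a point of
  \<open>A\<close>. Nonemptiness rules out the default value
  \<open>infdist x {} = 0\<close>.\<close>

lemma infdist_less_obtains:
  assumes "infdist x A < r" "A \<noteq> {}"
  obtains a where "a \<in> A" "dist x a < r"
proof -
  have "(INF a\<in>A. dist x a) < r"
    using assms by (simp add: infdist_notempty)
  then obtain a where "a \<in> A" "dist x a < r"
    using cINF_less_iff[OF assms(2) bdd_below_image_dist] by blast
  with that show thesis .
qed

lemma infdist_Un_less:
  assumes "infdist x (A \<union> B) < r" "A \<noteq> {}" "B \<noteq> {}"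
  shows "infdist x A < r \<or> infdist x B < r"
proof -
  obtain a where "a \<in> A \<union> B" "dist x a < r"
    using infdist_less_obtains[OF assms(1)] assms(2) by blast
  then show ?thesis
    by (meson UnE infdist_le le_less_trans)
qed

lemma gromov_product_le_dist_segment:
  assumes "geodesic_segment x y S" "w \<in> S"
  shows "gromov_product p x y \<le> dist w p"
  using geodesic_segment_dist_add[OF assms] dist_triangle[of x p w] dist_triangle[of y p w]
  by (simp add: gromov_product_def dist_commute)

lemma gromov_product_lipschitz: "gromov_product p x y - dist y y' \<le> gromov_product p x y'"
  using dist_triangle[of y p y'] dist_triangle[of x y' y]
  by (simp add: gromov_product_def dist_commute field_simps)

lemma gromov_product_change_base: "gromov_product p x y - dist p q \<le> gromov_product q x y"
  using dist_triangle[of x p q] dist_triangle[of y p q]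
  by (simp add: gromov_product_def dist_commute field_simps)

text \<open>A converse, up to \<open>2 * \<delta>\<close>, of
  \<open>gromov_product_le_dist_segment\<close>. The connected side \<open>A\<close> is covered by
  the open \<delta>-neighbourhoods of the other two sides, and each of these contains an endpoint of
  \<open>A\<close>; so some \<open>w\<close> on \<open>A\<close> lies in both.\<close>

lemma thin_triangle_centre:
  assumes thin: "\<forall>(x::'a::metric_space) y z A B C.
      geodesic_segment x y A \<and> geodesic_segment y z B \<and> geodesic_segment z x C \<longrightarrow>
      A \<subseteq> nbhd_of_set (B \<union> C) \<delta>"
    and "\<delta> > 0"
    and A: "geodesic_segment (x::'a) y A" and B: "geodesic_segment y p B"
    and C: "geodesic_segment p x C"
  obtains w where "w \<in> A" "dist w p \<le> gromov_product p x y + 2 * \<delta>"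
proof -
  obtain c where c: "c 0 = x" "c (dist x y) = y" "A = c ` {0..dist x y}"
    and iso: "\<forall>s\<in>{0..dist x y}. \<forall>t\<in>{0..dist x y}. dist (c s) (c t) = \<bar>s - t\<bar>"
    using A unfolding geodesic_segment_def by blast
  have "\<forall>s\<in>{0..dist x y}. \<forall>t\<in>{0..dist x y}. dist (c s) (c t) \<le> 1 * dist s t"
    using iso by (simp add: dist_real_def)
  then have "continuous_on {0..dist x y} c"
    by (intro lipschitz_on_continuous_on[of 1] lipschitz_onI) auto
  then have "connected A"
    unfolding c(3) by (intro connected_continuous_image) auto
  moreover have "open {w. infdist w S < \<delta>}" for S :: "'a set"
    by (intro open_Collect_less continuous_intros)
  moreover have ne: "B \<noteq> {}" "C \<noteq> {}"
    using geodesic_segment_endpoints B C by blast+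
  moreover have "A \<subseteq> {w. infdist w B < \<delta>} \<union> {w. infdist w C < \<delta>}"
  proof
    fix w assume "w \<in> A"
    moreover have "A \<subseteq> nbhd_of_set (B \<union> C) \<delta>"
      using thin A B C by blast
    ultimately have "infdist w (B \<union> C) < \<delta>"
      by (auto simp: nbhd_of_set_def)
    then show "w \<in> {w. infdist w B < \<delta>} \<union> {w. infdist w C < \<delta>}"
      using infdist_Un_less[OF _ ne] by blast
  qed
  moreover have "y \<in> {w. infdist w B < \<delta>} \<inter> A" "x \<in> {w. infdist w C < \<delta>} \<inter> A"
    using geodesic_segment_endpoints[OF A] geodesic_segment_endpoints(1)[OF B]
      geodesic_segment_endpoints(2)[OF C] \<open>\<delta> > 0\<close> by auto
  ultimately have "{w. infdist w B < \<delta>} \<inter> {w. infdist w C < \<delta>} \<inter> A \<noteq> {}"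
    using connectedD[of A "{w. infdist w B < \<delta>}" "{w. infdist w C < \<delta>}"] by blast
  then obtain w where w: "w \<in> A" "infdist w B < \<delta>" "infdist w C < \<delta>"
    by blast
  obtain u v where u: "u \<in> B" "dist w u < \<delta>" and v: "v \<in> C" "dist w v < \<delta>"
    using infdist_less_obtains w(2,3) ne by metis
  \<comment> \<open>The segment from \<open>y\<close> to \<open>p\<close> passes through
    \<open>u\<close>, so replacing \<open>u\<close> by \<open>w\<close> costs less than \<delta> in
    each of the two pieces; the same holds for \<open>v\<close> below.\<close>
  have "dist w y + dist w p - 2 * \<delta> \<le> dist y p"
    using geodesic_segment_dist_add[OF B u(1)] u(2) dist_triangle[of w y u] dist_triangle[of w p u]
    by (simp add: dist_commute)
  moreover have "dist w x + dist w p - 2 * \<delta> \<le> dist x p"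
    using geodesic_segment_dist_add[OF C v(1)] v(2) dist_triangle[of w x v] dist_triangle[of w p v]
    by (simp add: dist_commute)
  ultimately have "dist w p \<le> gromov_product p x y + 2 * \<delta>"
    using geodesic_segment_dist_add[OF A w(1)] by (simp add: gromov_product_def dist_commute field_simps)
  with w(1) that show thesis by blast
qed

text \<open>Gromov's four-point form of hyperbolicity, the form used in all later estimates. The
  parameter \<open>space_type\<close> ties the locale to \<open>'a\<close>, which \<delta> alone
  does not mention.\<close>

locale four_point_hyperbolic =
  fixes \<delta> :: real and space_type :: "'a::metric_space itself"
  assumes \<delta>_nonneg: "\<delta> \<ge> 0"
    and four_point: "\<And>p x y z :: 'a.
      min (gromov_product p x y) (gromov_product p y z) - \<delta> \<le> gromov_product p x z"

text \<open>A point \<open>w\<close> of the side \<open>x z\<close> realises the product of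
  \<open>x\<close> and \<open>z\<close> up to \<open>2 * \<delta>\<close>; thinness of the triangle
  \<open>x y z\<close> moves it by \<delta> to a point of one of the other sides, whose distance to
  \<open>p\<close> bounds the product along that side. Hence the constant
  \<open>3 * \<delta>\<close>.\<close>

lemma gromov_hyperbolic_imp_four_point:
  assumes "geodesic_space TYPE('a::metric_space)" "gromov_hyperbolic TYPE('a)"
  obtains \<delta> where "four_point_hyperbolic TYPE('a) \<delta>"
proof -
  obtain \<delta> where "\<delta> > 0"
    and thin: "\<forall>(x::'a) y z A B C.
      geodesic_segment x y A \<and> geodesic_segment y z B \<and> geodesic_segment z x C \<longrightarrow>
      A \<subseteq> nbhd_of_set (B \<union> C) \<delta>"
    using assms(2) unfolding gromov_hyperbolic_def by blast
  have "min (gromov_product p x y) (gromov_product p y z) - 3 * \<delta> \<le> gromov_product p x z"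
    for p x y z :: 'a
  proof -
    obtain XZ ZP PX XY YZ where seg: "geodesic_segment x z XZ" "geodesic_segment z p ZP"
        "geodesic_segment p x PX" "geodesic_segment x y XY" "geodesic_segment y z YZ"
      using assms(1) unfolding geodesic_space_def by metis
    obtain w where w: "w \<in> XZ" "dist w p \<le> gromov_product p x z + 2 * \<delta>"
      using thin_triangle_centre[OF thin \<open>\<delta> > 0\<close> seg(1-3)] by blast
    have "w \<in> nbhd_of_set (YZ \<union> XY) \<delta>"
      using thin seg(1) geodesic_segment_commute[OF seg(5)] geodesic_segment_commute[OF seg(4)] w(1)
      by blast
    then obtain v where v: "v \<in> YZ \<union> XY" "dist w v < \<delta>"
      using infdist_less_obtains geodesic_segment_endpoints(1)[OF seg(4)]
      unfolding nbhd_of_set_def by blast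
    have "min (gromov_product p x y) (gromov_product p y z) \<le> dist v p"
      using v(1) gromov_product_le_dist_segment seg(4,5) by (metis UnE min.coboundedI1 min.coboundedI2)
    also have "\<dots> \<le> dist w p + \<delta>"
      using v(2) dist_triangle[of v p w] by (simp add: dist_commute)
    finally show ?thesis using w(2) by simp
  qed
  then have "four_point_hyperbolic TYPE('a) (3 * \<delta>)"
    using \<open>\<delta> > 0\<close> by unfold_locales auto
  with that show thesis .
qed

section \<open>Gromov products with boundary points\<close>

lemma boundary_nonempty:
  assumes "\<xi> \<in> gromov_boundary"
  obtains c where "c \<in> \<xi>"
proof -
  from assms obtain c where "geodesic_ray c" "\<xi> = asymptotic_rays `` {c}"
    unfolding gromov_boundary_def quotient_def by blast
  moreover from this have "c \<in> \<xi>"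
    by (auto simp: asymptotic_rays_def intro!: exI[of _ 0])
  ultimately show thesis using that by blast
qed

lemma boundary_geodesic_ray:
  assumes "\<xi> \<in> gromov_boundary" "c \<in> \<xi>"
  shows "geodesic_ray c"
  using assms unfolding gromov_boundary_def quotient_def asymptotic_rays_def by auto

lemma boundary_asymptotic:
  assumes "\<xi> \<in> gromov_boundary" "c \<in> \<xi>" "c' \<in> \<xi>"
  obtains K where "\<And>t. t \<ge> 0 \<Longrightarrow> dist (c t) (c' t) \<le> K"
proof -
  from assms obtain b K K' where b: "\<forall>t\<ge>0. dist (b t) (c t) \<le> K" "\<forall>t\<ge>0. dist (b t) (c' t) \<le> K'"
    unfolding gromov_boundary_def quotient_def asymptotic_rays_def by auto
  have "dist (c t) (c' t) \<le> K + K'" if "t \<ge> 0" for t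
    using b that dist_triangle3[of "c t" "c' t" "b t"] by fastforce
  with that show thesis by blast
qed

text \<open>Distances to \<open>p\<close> grow like the parameters up to constants, while
  \<open>c s\<close> and \<open>c' t\<close> are at most \<open>\<bar>s - t\<bar> + K\<close> apart;
  then \<open>s + t - \<bar>s - t\<bar> = 2 * min s t\<close>.\<close>

lemma gromov_product_rays_ge:
  assumes "geodesic_ray c" "geodesic_ray c'" "\<And>t. t \<ge> 0 \<Longrightarrow> dist (c t) (c' t) \<le> K"
    and "s \<ge> 0" "t \<ge> 0"
  shows "min s t - (dist (c 0) p + dist (c' 0) p + K) / 2 \<le> gromov_product p (c s) (c' t)"
proof -
  have "dist (c s) (c 0) = s" "dist (c' t) (c' 0) = t" "dist (c s) (c t) = \<bar>s - t\<bar>"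
    using assms unfolding geodesic_ray_def by auto
  moreover have "dist (c s) (c 0) \<le> dist (c s) p + dist (c 0) p"
    "dist (c' t) (c' 0) \<le> dist (c' t) p + dist (c' 0) p"
    by (rule dist_triangle2)+
  moreover have "dist (c s) (c' t) \<le> dist (c s) (c t) + K"
    using dist_triangle[of "c s" "c' t" "c t"] assms(3)[OF \<open>t \<ge> 0\<close>] by linarith
  moreover have "s + t - \<bar>s - t\<bar> = 2 * min s t"
    by (simp add: min_def)
  ultimately show ?thesis
    by (simp add: gromov_product_def field_simps)
qed

lemma gromov_product_same_ray_ge:
  assumes "geodesic_ray c" "s \<ge> 0" "t \<ge> 0"
  shows "min s t - dist (c 0) p \<le> gromov_product p (c s) (c t)"
  using gromov_product_rays_ge[of c c 0 s t p] assms by simp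

text \<open>A strict lower bound on suprema and a limit inferior is witnessed by one pair of curves
  beyond a common threshold. The extended product is unfolded only here and in the next
  lemma.\<close>

lemma extended_gromov_product_gtE:
  assumes "extended_gromov_product p u v > ereal R"
  obtains c c' T where "c \<in> representatives u" "c' \<in> representatives v"
    "\<And>s t. s \<ge> T \<Longrightarrow> t \<ge> T \<Longrightarrow> gromov_product p (c s) (c' t) > R"
proof -
  obtain c c' where c: "c \<in> representatives u" "c' \<in> representatives v"
    and "Liminf (at_top \<times>\<^sub>F at_top) (\<lambda>(s, t). ereal (gromov_product p (c s) (c' t))) > ereal R"
    using assms unfolding extended_gromov_product_def less_SUP_iff by blast
  then have "\<forall>\<^sub>F (s, t) in at_top \<times>\<^sub>F at_top. gromov_product p (c s) (c' t) > R"
    by (auto dest!: less_LiminfD simp: case_prod_unfold)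
  then obtain P Q where "eventually P at_top" "eventually Q at_top"
    and PQ: "\<And>s t. P s \<Longrightarrow> Q t \<Longrightarrow> gromov_product p (c s) (c' t) > R"
    unfolding eventually_prod_filter by auto
  then obtain a b where "\<And>s. s \<ge> a \<Longrightarrow> P s" "\<And>t. t \<ge> b \<Longrightarrow> Q t"
    unfolding eventually_at_top_linorder by blast
  then show thesis using that[OF c, of "max a b"] PQ by simp
qed

text \<open>A limit inferior preserves only weak bounds; the gap between \<open>R\<close> and
  \<open>R'\<close> restores strictness and is the source of the unit slack in later
  constants.\<close>

lemma extended_gromov_product_gtI:
  assumes "c \<in> representatives u" "c' \<in> representatives v"
    and "\<And>s t. s \<ge> T \<Longrightarrow> t \<ge> T \<Longrightarrow> gromov_product p (c s) (c' t) \<ge> R'" and "R' > R"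
  shows "extended_gromov_product p u v > ereal R"
proof -
  have "\<forall>\<^sub>F x in at_top \<times>\<^sub>F at_top. T \<le> fst x \<and> T \<le> snd x"
    by (rule eventually_prodI[OF eventually_ge_at_top eventually_ge_at_top])
  then have "\<forall>\<^sub>F x in at_top \<times>\<^sub>F at_top.
      ereal R' \<le> (case x of (s, t) \<Rightarrow> ereal (gromov_product p (c s) (c' t)))"
    by (rule eventually_mono) (use assms(3) in fastforce)
  then have "Liminf (at_top \<times>\<^sub>F at_top) (\<lambda>(s, t). ereal (gromov_product p (c s) (c' t))) \<ge> ereal R'"
    by (rule Liminf_bounded)
  then have "extended_gromov_product p u v \<ge> ereal R'"
    unfolding extended_gromov_product_def 
    by (rule SUP_upper2[OF assms(1) SUP_upper2[OF assms(2)]])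
  then show ?thesis using assms(4) by (meson less_ereal.simps(1) less_le_trans)
qed

lemma extended_gromov_product_change_base:
  assumes "extended_gromov_product p u v > ereal (R + dist p q + 1)"
  shows "extended_gromov_product q u v > ereal R"
proof -
  obtain c c' T where c: "c \<in> representatives u" "c' \<in> representatives v"
    and T: "\<And>s t. s \<ge> T \<Longrightarrow> t \<ge> T \<Longrightarrow> gromov_product p (c s) (c' t) > R + dist p q + 1"
    using extended_gromov_product_gtE assms by blast
  have "gromov_product q (c s) (c' t) \<ge> R + 1" if "s \<ge> T" "t \<ge> T" for s t
    using T[OF that] gromov_product_change_base[of p "c s" "c' t" q] by linarith
  with c show ?thesis by (rule extended_gromov_product_gtI) auto
qed

lemma extended_gromov_product_lipschitz:
  assumes "extended_gromov_product p u (Inl x) > ereal (R + dist x y + 1)"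
  shows "extended_gromov_product p u (Inl y) > ereal R"
proof -
  obtain c c' T where c: "c \<in> representatives u" and c': "c' \<in> representatives (Inl x)"
    and "\<And>s t. s \<ge> T \<Longrightarrow> t \<ge> T \<Longrightarrow> gromov_product p (c s) (c' t) > R + dist x y + 1"
    using extended_gromov_product_gtE[OF assms] by blast
  then have T: "gromov_product p (c s) x > R + dist x y + 1" if "s \<ge> T" for s
    using that by auto
  have "gromov_product p (c s) y \<ge> R + 1" if "s \<ge> T" for s
    using T[OF that] gromov_product_lipschitz[of p "c s" x y] by linarith
  with c show ?thesis
    by (intro extended_gromov_product_gtI[of c _ "\<lambda>_. y" _ T "R + 1"]) auto
qed

section \<open>Neighbourhoods of boundary points and convergence to them\<close>

lemma eventually_at_boundary:
  assumes "\<xi> \<in> gromov_boundary"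
  shows "eventually P (at_boundary \<xi>) \<longleftrightarrow>
    (\<exists>U. gromov_open U \<and> Inr \<xi> \<in> U \<and> (\<forall>z. Inl z \<in> U \<longrightarrow> P z))"
proof -
  \<comment> \<open>Outside the topspace \<open>nhdsin\<close> is \<open>bot\<close>, so membership
    is established first.\<close>
  have "Inr \<xi> \<in> topspace gromov_compactification"
    using assms by (simp add: topspace_gromov_compactification gromov_points_def)
  then show ?thesis
    unfolding at_boundary_def eventually_filtercomap eventually_nhdsin
      openin_gromov_compactification
    by (intro iffI; elim exE conjE)
      (blast, intro exI[of _ "\<lambda>u. u \<in> _"], blast)
qed

text \<open>Read off from \<open>gromov_open\<close>. The converse, that superlevel sets are
  neighbourhoods, is \<open>eventually_extended_product_gt\<close> and rests on the four-point
  inequality.\<close>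

lemma eventually_at_boundaryD:
  assumes "\<xi> \<in> gromov_boundary" "eventually P (at_boundary \<xi>)"
  obtains r where "\<And>z. extended_gromov_product p (Inr \<xi>) (Inl z) > ereal r \<Longrightarrow> P z"
proof -
  obtain U where "gromov_open U" "Inr \<xi> \<in> U" and U: "\<forall>z. Inl z \<in> U \<longrightarrow> P z"
    using assms eventually_at_boundary by blast
  then obtain r where "{u \<in> gromov_points. extended_gromov_product p (Inr \<xi>) u > ereal r} \<subseteq> U"
    unfolding gromov_open_def by blast
  with U that[of r] show thesis by (auto simp: gromov_points_def)
qed

text \<open>The sequence stays in the space, so only the traces of open sets on the space matter,
  and these are what \<open>at_boundary\<close> records.\<close>

lemma converges_to_boundary_iff:
  assumes "\<xi> \<in> gromov_boundary"
  shows "converges_to_boundary x \<xi> \<longleftrightarrow> filterlim x (at_boundary \<xi>) sequentially"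
proof -
  have "Inr \<xi> \<in> topspace gromov_compactification"
    using assms by (simp add: topspace_gromov_compactification gromov_points_def)
  then have conv: "converges_to_boundary x \<xi> \<longleftrightarrow>
      (\<forall>U. gromov_open U \<and> Inr \<xi> \<in> U \<longrightarrow> (\<forall>\<^sub>F n in sequentially. Inl (x n) \<in> U))"
    by (simp add: converges_to_boundary_def limitin_def openin_gromov_compactification)
  show ?thesis
    unfolding filterlim_iff
  proof (intro iffI allI impI)
    fix P assume x: "converges_to_boundary x \<xi>" and "eventually P (at_boundary \<xi>)"
    then obtain U where "gromov_open U" "Inr \<xi> \<in> U" and U: "\<And>z. Inl z \<in> U \<Longrightarrow> P z"
      using eventually_at_boundary[OF assms] by blast
    with x have "\<forall>\<^sub>F n in sequentially. Inl (x n) \<in> U"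
      using conv by blast
    then show "\<forall>\<^sub>F n in sequentially. P (x n)"
      using U by (rule eventually_mono)
  next
    assume x: "\<forall>P. eventually P (at_boundary \<xi>) \<longrightarrow> (\<forall>\<^sub>F n in sequentially. P (x n))"
    have "\<forall>\<^sub>F z in at_boundary \<xi>. Inl z \<in> U" if "gromov_open U" "Inr \<xi> \<in> U" for U
      using that eventually_at_boundary[OF assms] by blast
    with x show "converges_to_boundary x \<xi>"
      unfolding conv by blast
  qed
qed

lemma ray_tendsto_boundary:
  assumes "\<xi> \<in> gromov_boundary" "\<gamma> \<in> \<xi>"
  shows "filterlim \<gamma> (at_boundary \<xi>) at_top"
  unfolding filterlim_iff
proof (intro allI impI)
  fix P assume "eventually P (at_boundary \<xi>)"
  then obtain r where r: "\<And>z. extended_gromov_product (\<gamma> 0) (Inr \<xi>) (Inl z) > ereal r \<Longrightarrow> P z"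
    using eventually_at_boundaryD assms(1) by blast
  \<comment> \<open>The ray itself serves as representative of \<xi>, and the base point
    \<open>\<gamma> 0\<close> makes the error term vanish. The threshold is nonnegative and at least
    \<open>r + 1\<close>.\<close>
  have "P (\<gamma> t)" if "t \<ge> \<bar>r\<bar> + 1" for t
  proof (intro r extended_gromov_product_gtI)
    show "gromov_product (\<gamma> 0) (\<gamma> s) (\<gamma> t) \<ge> r + 1" if "s \<ge> t" for s
    proof -
      have "min s t - dist (\<gamma> 0) (\<gamma> 0) \<le> gromov_product (\<gamma> 0) (\<gamma> s) (\<gamma> t)"
        using boundary_geodesic_ray[OF assms] that \<open>t \<ge> \<bar>r\<bar> + 1\<close>
        by (intro gromov_product_same_ray_ge) auto
      with that \<open>t \<ge> \<bar>r\<bar> + 1\<close> show ?thesis by simp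
    qed
  qed (use assms in auto)
  then show "\<forall>\<^sub>F t in at_top. P (\<gamma> t)"
    unfolding eventually_at_top_linorder by blast
qed

section \<open>The four-point inequality at the boundary\<close>

context four_point_hyperbolic
begin

text \<open>The two hypotheses may choose different rays \<open>b\<close> and \<open>b'\<close> of
  \<xi>. Being asymptotic, these have large product far out, so the chain \<open>a s\<close>,
  \<open>b t\<close>, \<open>b' t\<close>, \<open>e s'\<close> takes two four-point steps.\<close>

lemma extended_four_point:
  fixes p :: 'a
  assumes "\<xi> \<in> gromov_boundary"
    and u: "extended_gromov_product p u (Inr \<xi>) > ereal R"
    and v: "extended_gromov_product p (Inr \<xi>) v > ereal R"
  shows "extended_gromov_product p u v > ereal (R - 2 * \<delta> - 1)"
proof -
  obtain a b T where a: "a \<in> representatives u" "b \<in> \<xi>"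
    and T: "\<And>s t. s \<ge> T \<Longrightarrow> t \<ge> T \<Longrightarrow> gromov_product p (a s) (b t) > R"
    using extended_gromov_product_gtE[OF u] by (metis representatives.simps(2))
  obtain b' e T' where e: "b' \<in> \<xi>" "e \<in> representatives v"
    and T': "\<And>s t. s \<ge> T' \<Longrightarrow> t \<ge> T' \<Longrightarrow> gromov_product p (b' s) (e t) > R"
    using extended_gromov_product_gtE[OF v] by (metis representatives.simps(2))
  obtain K where K: "\<And>t. t \<ge> 0 \<Longrightarrow> dist (b t) (b' t) \<le> K"
    using boundary_asymptotic assms(1) a(2) e(1) by blast
  \<comment> \<open>The first three entries make \<open>t\<close> admissible for all bounds; the
    last makes the product of \<open>b t\<close> and \<open>b' t\<close> at least
    \<open>R\<close>.\<close>
  define t where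
    "t = Max {0, T, T', R + (dist (b 0) p + dist (b' 0) p + K) / 2}"
  have t: "t \<ge> 0" "t \<ge> T" "t \<ge> T'" "t \<ge> R + (dist (b 0) p + dist (b' 0) p + K) / 2"
    by (simp_all add: t_def)
  have mid: "gromov_product p (b t) (b' t) \<ge> R"
    using gromov_product_rays_ge[of b b' K t t p] K t(1,4)
      boundary_geodesic_ray assms(1) a(2) e(1) by force
  have "gromov_product p (a s) (e s') \<ge> R - 2 * \<delta>" if "s \<ge> max T T'" "s' \<ge> max T T'" for s s'
  proof -
    have "gromov_product p (a s) (b' t) \<ge> R - \<delta>"
      using four_point[of p "a s" "b t" "b' t"] T[of s t] mid that t(2) by simp
    moreover have "gromov_product p (b' t) (e s') > R"
      using T'[of t s'] that t(3) by simp
    ultimately show ?thesis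
      using four_point[of p "a s" "b' t" "e s'"] \<delta>_nonneg by linarith
  qed
  then show ?thesis
    using a(1) e(2) by (intro extended_gromov_product_gtI[of a _ e _ "max T T'" "R - 2 * \<delta>"]) auto
qed

text \<open>The superlevel sets of the extended product are not open themselves: the open set consists of
  the points that have a basic neighbourhood in such a superlevel set.\<close>

lemma eventually_extended_product_gt:
  fixes p :: 'a
  assumes "\<eta> \<in> gromov_boundary"
  shows "\<forall>\<^sub>F z in at_boundary \<eta>. extended_gromov_product p (Inr \<eta>) (Inl z) > ereal R"
proof -
  let ?B = "\<lambda>q \<xi> r. {u \<in> gromov_points. extended_gromov_product q (Inr \<xi>) u > ereal r}"
  define N where "N = ?B p \<eta> R"
  define U where "U = Inl ` interior (Inl -` N) \<union> Inr ` {\<xi>\<in>gromov_boundary. \<exists>r. ?B p \<xi> r \<subseteq> N}"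
  \<comment> \<open>Of the margin \<open>2\<close>, one unit pays for moving within
    \<open>ball x 1\<close> and one for strictness.\<close>
  have interior: "x \<in> interior (Inl -` N)"
    if r: "?B p \<xi> r \<subseteq> N" and x: "extended_gromov_product p (Inr \<xi>) (Inl x) > ereal (r + 2)"
    for \<xi> r x
  proof -
    have "ball x 1 \<subseteq> Inl -` N"
    proof
      fix y assume "y \<in> ball x 1"
      then have "ereal (r + dist x y + 1) < extended_gromov_product p (Inr \<xi>) (Inl x)"
        using x by (intro le_less_trans[OF _ x]) simp
      then have "extended_gromov_product p (Inr \<xi>) (Inl y) > ereal r"
        by (rule extended_gromov_product_lipschitz)
      with r show "y \<in> Inl -` N" by (auto simp: gromov_points_def)
    qed
    then show ?thesis by (intro interiorI[of "ball x 1"]) auto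
  qed
  \<comment> \<open>One margin for both kinds of points: \<open>2\<close> suffices for
    \<open>interior\<close>, and \<open>2 * \<delta> + 1\<close> is the loss in
    \<open>extended_four_point\<close>.\<close>
  have basic: "?B p \<xi> (r + 2 * \<delta> + 2) \<subseteq> U" if "\<xi> \<in> gromov_boundary" and r: "?B p \<xi> r \<subseteq> N" for \<xi> r
  proof
    fix u assume "u \<in> ?B p \<xi> (r + 2 * \<delta> + 2)"
    then have u: "u \<in> gromov_points" "extended_gromov_product p (Inr \<xi>) u > ereal (r + 2 * \<delta> + 2)"
      by auto
    show "u \<in> U"
    proof (cases u)
      case (Inl x)
      have "extended_gromov_product p (Inr \<xi>) (Inl x) > ereal (r + 2)"
        using u(2) \<delta>_nonneg unfolding Inl by (intro le_less_trans[OF _ u(2)[unfolded Inl]]) simp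
      with interior[OF r] Inl show ?thesis by (simp add: U_def)
    next
      case (Inr \<zeta>)
      then have \<zeta>: "\<zeta> \<in> gromov_boundary" using u(1) by (auto simp: gromov_points_def)
      have "?B p \<zeta> (r + 2 * \<delta> + 2) \<subseteq> ?B p \<xi> r"
      proof clarify
        fix v assume v: "extended_gromov_product p (Inr \<zeta>) v > ereal (r + 2 * \<delta> + 2)"
        have "ereal r \<le> ereal (r + 2 * \<delta> + 2 - 2 * \<delta> - 1)" by simp
        also have "\<dots> < extended_gromov_product p (Inr \<xi>) v"
          using extended_four_point[OF \<zeta> u(2)[unfolded Inr] v] .
        finally show "extended_gromov_product p (Inr \<xi>) v > ereal r" .
      qed
      with r \<zeta> Inr show ?thesis unfolding U_def by blast
    qed
  qed
  have "gromov_open U"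
    unfolding gromov_open_def
  proof (intro conjI allI impI)
    show "U \<subseteq> gromov_points" by (auto simp: U_def gromov_points_def)
    have "Inl -` U = interior (Inl -` N)" by (auto simp: U_def)
    then show "open (Inl -` U)" by simp
    fix \<xi> q assume "Inr \<xi> \<in> U"
    then obtain r where "\<xi> \<in> gromov_boundary" "?B p \<xi> r \<subseteq> N"
      by (auto simp: U_def)
    then have "?B p \<xi> (r + 2 * \<delta> + 2) \<subseteq> U"
      by (rule basic)
    \<comment> \<open>\<open>U\<close> was built with the base point \<open>p\<close>, whereas
      \<open>gromov_open\<close> asks for every base point \<open>q\<close>.\<close>
    moreover have "?B q \<xi> (r + 2 * \<delta> + 2 + dist q p + 1) \<subseteq> ?B p \<xi> (r + 2 * \<delta> + 2)"
      using extended_gromov_product_change_base by blast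
    ultimately show "\<exists>r. ?B q \<xi> r \<subseteq> U" by blast
  qed
  moreover have "Inr \<eta> \<in> U"
    using assms by (auto simp: U_def N_def)
  moreover have "extended_gromov_product p (Inr \<eta>) (Inl z) > ereal R" if "Inl z \<in> U" for z
    using that interior_subset[of "Inl -` N"] by (auto simp: U_def N_def)
  ultimately show ?thesis
    unfolding eventually_at_boundary[OF assms] by blast
qed

text \<open>The supremum in the extended product selects some ray \<open>c\<close> of \<eta>;
  passing to the prescribed ray \<gamma> through \<open>c t\<close> costs one \<delta>.\<close>

lemma ray_product_ge:
  fixes p :: 'a
  assumes "\<eta> \<in> gromov_boundary" "\<gamma> \<in> \<eta>"
    and z: "extended_gromov_product p (Inr \<eta>) (Inl z) > ereal R"
  shows "\<forall>\<^sub>F t in at_top. gromov_product p (\<gamma> t) z \<ge> R - \<delta>"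
proof -
  obtain c c' T where "c \<in> representatives (Inr \<eta>)" "c' \<in> representatives (Inl z)"
    and "\<And>s t. s \<ge> T \<Longrightarrow> t \<ge> T \<Longrightarrow> gromov_product p (c s) (c' t) > R"
    using extended_gromov_product_gtE[OF z] by blast
  then have c: "c \<in> \<eta>" and T: "gromov_product p (c s) z > R" if "s \<ge> T" for s
    using that by auto
  obtain K where K: "\<And>t. t \<ge> 0 \<Longrightarrow> dist (\<gamma> t) (c t) \<le> K"
    using boundary_asymptotic assms(1,2) c by blast
  define t\<^sub>0 where "t\<^sub>0 = Max {0, T, R + (dist (\<gamma> 0) p + dist (c 0) p + K) / 2}"
  have "gromov_product p (\<gamma> t) z \<ge> R - \<delta>" if "t \<ge> t\<^sub>0" for t
  proof -
    have t: "t \<ge> 0" "t \<ge> T" "t \<ge> R + (dist (\<gamma> 0) p + dist (c 0) p + K) / 2"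
      using that by (simp_all add: t\<^sub>0_def)
    have "gromov_product p (\<gamma> t) (c t) \<ge> R"
      using gromov_product_rays_ge[of \<gamma> c K t t p] K t(1,3)
        boundary_geodesic_ray assms(1,2) c by force
    then show ?thesis
      using four_point[of p "\<gamma> t" "c t" z] T[OF t(2)] by linarith
  qed
  then show ?thesis unfolding eventually_at_top_linorder by blast
qed

text \<open>A far point \<open>\<gamma> t\<close> links \<open>\<gamma> T\<close> to
  \<open>z\<close>, so their product is at least \<open>T\<close> up to a constant, while
  \<open>dist (\<gamma> T) p\<close> exceeds \<open>T\<close> by at most
  \<open>dist (\<gamma> 0) p\<close>. Rewriting the product as distances gives the bound.\<close>

lemma dist_ray_le:
  fixes p :: 'a
  assumes "\<eta> \<in> gromov_boundary" "\<gamma> \<in> \<eta>" "T \<ge> 0"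
    and z: "extended_gromov_product p (Inr \<eta>) (Inl z) > ereal T"
  shows "dist z (\<gamma> T) \<le> dist z p - T + 3 * dist (\<gamma> 0) p + 4 * \<delta>"
proof -
  have ray: "geodesic_ray \<gamma>" using boundary_geodesic_ray assms(1,2) .
  have "\<forall>\<^sub>F t in at_top. gromov_product p (\<gamma> t) z \<ge> T - \<delta> \<and> t \<ge> T"
    using ray_product_ge[OF assms(1,2) z] eventually_ge_at_top by (rule eventually_conj)
  then obtain t where t: "gromov_product p (\<gamma> t) z \<ge> T - \<delta>" "t \<ge> T"
    by (auto simp: eventually_at_top_linorder)
  have "gromov_product p (\<gamma> T) (\<gamma> t) \<ge> T - dist (\<gamma> 0) p"
    using gromov_product_same_ray_ge[OF ray, of T t p] t(2) \<open>T \<ge> 0\<close> by simp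
  then have "gromov_product p (\<gamma> T) z \<ge> T - dist (\<gamma> 0) p - 2 * \<delta>"
    using four_point[of p "\<gamma> T" "\<gamma> t" z] t(1) \<delta>_nonneg zero_le_dist[of "\<gamma> 0" p] by linarith
  moreover have "dist (\<gamma> T) p \<le> T + dist (\<gamma> 0) p"
    using ray \<open>T \<ge> 0\<close> dist_triangle[of "\<gamma> T" p "\<gamma> 0"] unfolding geodesic_ray_def by auto
  ultimately show ?thesis by (simp add: gromov_product_def dist_commute field_simps)
qed

section \<open>Unrestricted limits under a bound on the displacement\<close>

text \<open>One ray point \<open>y\<close>, depending on \<open>P\<close> and \<open>C\<close> but
  not on \<open>z\<close>, is fixed first; the images of all \<open>z\<close> near \<eta> are then
  compared with the single point \<open>f y\<close>.\<close>

lemma eventually_image_near_boundary: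
  fixes f :: "'a \<Rightarrow> 'a" and p :: 'a
  assumes \<eta>: "\<eta> \<in> gromov_boundary"
    and nonexpanding: "\<And>x y. dist (f x) (f y) \<le> dist x y"
    and lim: "has_geodesic_limit f \<eta> \<eta>"
    and P: "eventually P (at_boundary \<eta>)"
  shows "\<forall>\<^sub>F z in at_boundary \<eta>. dist z p - dist (f z) p \<le> C \<longrightarrow> P (f z)"
proof -
  obtain r where r: "\<And>z. extended_gromov_product p (Inr \<eta>) (Inl z) > ereal r \<Longrightarrow> P z"
    using eventually_at_boundaryD \<eta> P by blast
  obtain \<gamma> where \<gamma>: "\<gamma> \<in> \<eta>" using boundary_nonempty \<eta> by blast
  \<comment> \<open>One \<delta> is lost in \<open>ray_product_ge\<close>, one in the four-point
    step through \<open>f y\<close>, and \<open>1\<close> gives strictness.\<close>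
  define R where "R = r + 2 * \<delta> + 1"
  have "filterlim (\<lambda>n. \<gamma> (real n)) (at_boundary \<eta>) sequentially"
    using ray_tendsto_boundary[OF \<eta> \<gamma>] filterlim_real_sequentially by (rule filterlim_compose)
  then have "converges_to_boundary (\<lambda>n. \<gamma> (real n)) \<eta>"
    using converges_to_boundary_iff[OF \<eta>] by blast
  moreover have "\<gamma> (real n) \<in> geodesic_region \<gamma> 1" for n
    by (simp add: geodesic_region_def nbhd_of_set_def)
  ultimately have "converges_to_boundary (\<lambda>n. f (\<gamma> (real n))) \<eta>"
    using lim \<gamma> unfolding has_geodesic_limit_def by (metis zero_less_one)
  then have "\<forall>\<^sub>F n in sequentially. extended_gromov_product p (Inr \<eta>) (Inl (f (\<gamma> (real n)))) > ereal R"
    unfolding converges_to_boundary_iff[OF \<eta>] filterlim_iff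
    using eventually_extended_product_gt[OF \<eta>] by blast
  \<comment> \<open>This threshold is what turns \<open>dist_ray_le\<close> and the bound
    \<open>C\<close> into \<open>dist (f z) (f y) \<le> dist (f z) p - 2 * R\<close>.\<close>
  moreover have "\<forall>\<^sub>F n in sequentially. real n \<ge> 2 * R + C + 3 * dist (\<gamma> 0) p + 4 * \<delta>"
    using filterlim_real_sequentially unfolding filterlim_at_top by blast
  ultimately have "\<forall>\<^sub>F n in sequentially.
      extended_gromov_product p (Inr \<eta>) (Inl (f (\<gamma> (real n)))) > ereal R \<and>
      real n \<ge> 2 * R + C + 3 * dist (\<gamma> 0) p + 4 * \<delta>"
    by (rule eventually_conj)
  then obtain n where
    n: "extended_gromov_product p (Inr \<eta>) (Inl (f (\<gamma> (real n)))) > ereal R"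
    and large: "real n \<ge> 2 * R + C + 3 * dist (\<gamma> 0) p + 4 * \<delta>"
    by (auto simp: eventually_sequentially)
  define y where "y = \<gamma> (real n)"
  have "\<forall>\<^sub>F t in at_top. gromov_product p (\<gamma> t) (f y) \<ge> R - \<delta>"
    using ray_product_ge[OF \<eta> \<gamma> n] by (simp add: y_def)
  then obtain T where T: "\<And>t. t \<ge> T \<Longrightarrow> gromov_product p (\<gamma> t) (f y) \<ge> R - \<delta>"
    unfolding eventually_at_top_linorder by blast
  show ?thesis
    using eventually_extended_product_gt[OF \<eta>, of "real n" p]
  proof eventually_elim
    case (elim z)
    show ?case
    proof
      assume C: "dist z p - dist (f z) p \<le> C"
      have "dist (f z) (f y) \<le> dist z y" by (rule nonexpanding)
      also have "\<dots> \<le> dist z p - real n + 3 * dist (\<gamma> 0) p + 4 * \<delta>"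
        using dist_ray_le[OF \<eta> \<gamma> _ elim] by (simp add: y_def)
      finally have "dist (f z) (f y) \<le> dist (f z) p - 2 * R"
        using C large by linarith
      \<comment> \<open>The product gains \<open>R\<close> from the last estimate, and the remaining
        term \<open>dist (f y) p / 2\<close> is nonnegative.\<close>
      then have fz: "gromov_product p (f y) (f z) \<ge> R"
        by (simp add: gromov_product_def dist_commute[of "f y" "f z"] field_simps add_increasing)
      have "gromov_product p (\<gamma> t) (f z) \<ge> r + 1" if "t \<ge> T" for t
        using four_point[of p "\<gamma> t" "f y" "f z"] T[OF that] fz \<delta>_nonneg
        unfolding R_def by linarith
      then show "P (f z)"
        using \<gamma> by (intro r extended_gromov_product_gtI[of \<gamma> _ "\<lambda>_. f z" _ T "r + 1"]) auto
    qed
  qed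
qed

end

section \<open>Iterates of the map and superadditivity\<close>

lemma funpow_nonexpanding:
  fixes f :: "'a::metric_space \<Rightarrow> 'a"
  assumes "\<And>x y. dist (f x) (f y) \<le> dist x y"
  shows "dist ((f ^^ n) x) ((f ^^ n) y) \<le> dist x y"
  by (induction n) (auto intro: order_trans assms)

lemma nonexpanding_dist_image_le:
  assumes "dist (g x) (g p) \<le> dist x p"
  shows "dist (g x) p \<le> dist x p + dist (g p) p"
  using assms dist_triangle[of "g x" p "g p"] by simp

text \<open>The displacement of \<open>f ^^ Suc m\<close> at \<open>z\<close> is that of
  \<open>f ^^ m\<close> at \<open>z\<close> plus that of \<open>f\<close> at
  \<open>(f ^^ m) z\<close>. Both are bounded below by nonexpansion, so an upper bound on the sum
  bounds each. \<open>P\<close> is pulled back through \<open>f\<close> first, hence the induction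
  is over arbitrary \<open>P\<close> and \<open>C\<close>.\<close>

lemma (in four_point_hyperbolic) eventually_funpow_near_boundary:
  fixes f :: "'a \<Rightarrow> 'a" and p :: 'a
  assumes \<eta>: "\<eta> \<in> gromov_boundary"
    and nonexpanding: "\<And>x y. dist (f x) (f y) \<le> dist x y"
    and lim: "has_geodesic_limit f \<eta> \<eta>"
    and "eventually P (at_boundary \<eta>)"
  shows "\<forall>\<^sub>F z in at_boundary \<eta>. dist z p - dist ((f ^^ m) z) p \<le> C \<longrightarrow> P ((f ^^ m) z)"
  using assms(4)
proof (induction m arbitrary: P C)
  case 0
  then show ?case by (auto elim: eventually_mono)
next
  case (Suc m)
  \<comment> \<open>The added constant is the negative of the lower bound for the displacement of
    \<open>f ^^ m\<close>.\<close>
  define Q where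
    "Q w \<longleftrightarrow> (dist w p - dist (f w) p \<le> C + dist ((f ^^ m) p) p \<longrightarrow> P (f w))" for w
  have "eventually Q (at_boundary \<eta>)"
    unfolding Q_def using eventually_image_near_boundary[OF \<eta> nonexpanding lim Suc.prems] .
  then have "\<forall>\<^sub>F z in at_boundary \<eta>. dist z p - dist ((f ^^ m) z) p \<le> C + dist (f p) p \<longrightarrow> Q ((f ^^ m) z)"
    by (rule Suc.IH)
  then show ?case
  proof eventually_elim
    case (elim z)
    have "dist (f ((f ^^ m) z)) p \<le> dist ((f ^^ m) z) p + dist (f p) p"
      "dist ((f ^^ m) z) p \<le> dist z p + dist ((f ^^ m) p) p"
      using nonexpanding funpow_nonexpanding[of f, OF nonexpanding]
      by (simp_all add: nonexpanding_dist_image_le)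
    with elim show ?case by (auto simp: Q_def)
  qed
qed

text \<open>Sums of real minorants come arbitrarily close to \<open>A + B\<close>; excluding
  \<open>-\<infinity>\<close> guarantees that such minorants exist. The value
  \<open>\<infinity>\<close> is allowed, so the final estimate can be made with reals without first
  proving the dilations of the iterates finite.\<close>

lemma ereal_add_leI:
  fixes A B L :: ereal
  assumes "A \<noteq> -\<infinity>" "B \<noteq> -\<infinity>"
    and le: "\<And>a b. ereal a < A \<Longrightarrow> ereal b < B \<Longrightarrow> ereal (a + b) \<le> L"
  shows "A + B \<le> L"
proof (rule dense_le)
  fix x assume x: "x < A + B"
  have "\<exists>a b. ereal a < A \<and> ereal b < B \<and> x \<le> ereal (a + b)"
  proof (cases x)
    case (real r)
    show ?thesis
    proof (cases A)
      case (real A')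
      show ?thesis
      proof (cases B)
        case (real B')
        \<comment> \<open>The excess of \<open>A' + B'\<close> over \<open>r\<close> is shared
          equally between the two summands.\<close>
        define e where "e = (A' + B' - r) / 2"
        have "e > 0" "r = (A' - e) + (B' - e)"
          using x \<open>x = ereal r\<close> \<open>A = ereal A'\<close> real by (simp_all add: e_def field_simps)
        then show ?thesis
          using \<open>x = ereal r\<close> \<open>A = ereal A'\<close> real
          by (intro exI[of _ "A' - e"] exI[of _ "B' - e"]) simp
      next
        case PInf
        then show ?thesis
          using \<open>x = ereal r\<close> \<open>A = ereal A'\<close>
          by (intro exI[of _ "A' - 1"] exI[of _ "r - A' + 1"]) simp
      qed (use assms in simp)
    next
      case PInf
      obtain b where "ereal b < B"
        using assms(2) ereal_dense2[of "-\<infinity>" B] by auto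
      then show ?thesis
        using \<open>x = ereal r\<close> PInf by (intro exI[of _ "r - b"] exI[of _ b]) simp
    qed (use assms in simp)
  next
    case MInf
    obtain a b where "ereal a < A" "ereal b < B"
      using assms(1,2) ereal_dense2[of "-\<infinity>"] by (metis ereal_MInfty_lessI)
    with MInf show ?thesis by auto
  qed (use x in auto)
  with le show "x \<le> L" by (meson order_trans)
qed

theorem theorem4p6:
  fixes f :: "'a::metric_space \<Rightarrow> 'a" and p :: 'a and \<eta> :: "(real \<Rightarrow> 'a) set"
  assumes "proper_space TYPE('a)"
    and "geodesic_space TYPE('a)"
    and "gromov_hyperbolic TYPE('a)"
    and nonexpanding: "\<And>x y. dist (f x) (f y) \<le> dist x y"
    and "\<eta> \<in> gromov_boundary"
    and "boundary_regular_fixed_point f \<eta>"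
  shows "\<forall>n\<ge>1. \<forall>m\<ge>1.
    log_dilation \<eta> p (f ^^ (n + m)) \<ge> log_dilation \<eta> p (f ^^ n) + log_dilation \<eta> p (f ^^ m)"
proof (intro allI impI)
  fix n m :: nat
  obtain \<delta> where "four_point_hyperbolic TYPE('a) \<delta>"
    using gromov_hyperbolic_imp_four_point assms(2,3) by blast
  then interpret four_point_hyperbolic \<delta> "TYPE('a)" .
  let ?F = "at_boundary \<eta>"
  define h where "h k z = dist z p - dist ((f ^^ k) z) p" for k z
  have lim: "has_geodesic_limit f \<eta> \<eta>"
    using assms(6) by (simp add: boundary_regular_fixed_point_def)
  have L: "log_dilation \<eta> p (f ^^ k) = Liminf ?F (\<lambda>z. ereal (h k z))" for k
    by (simp add: log_dilation_def h_def)
  have bound: "h k z \<ge> - dist ((f ^^ k) p) p" for k z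
    using nonexpanding_dist_image_le[of "f ^^ k" z p]
      funpow_nonexpanding[of f, OF nonexpanding, of k z p] by (simp add: h_def)
  have not_MInf: "log_dilation \<eta> p (f ^^ k) \<noteq> -\<infinity>" for k
  proof -
    have "ereal (- dist ((f ^^ k) p) p) \<le> log_dilation \<eta> p (f ^^ k)"
      unfolding L by (intro Liminf_bounded always_eventually allI) (simp add: bound)
    then show ?thesis by auto
  qed
  have real_bound: "ereal (a + b) \<le> log_dilation \<eta> p (f ^^ (n + m))"
    if a: "ereal a < log_dilation \<eta> p (f ^^ n)" and b: "ereal b < log_dilation \<eta> p (f ^^ m)" for a b
  proof -
    have "\<forall>\<^sub>F z in ?F. h n z > a" "\<forall>\<^sub>F z in ?F. h m z > b"
      using a b unfolding L by (auto dest: less_LiminfD)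
    \<comment> \<open>The constant splits two cases. If \<open>h m z\<close> exceeds it, the lower
      bound \<open>- dist ((f ^^ n) p) p\<close> on the other summand already gives a sum above
      \<open>a + b\<close>; otherwise \<open>(f ^^ m) z\<close> is close enough to \<eta> for the
      bound \<open>a\<close> to apply there.\<close>
    moreover from this(1) have "\<forall>\<^sub>F z in ?F.
        h m z \<le> a + b + dist ((f ^^ n) p) p \<longrightarrow> h n ((f ^^ m) z) > a"
      unfolding h_def[of m]
      by (rule eventually_funpow_near_boundary[OF assms(5) nonexpanding lim])
    ultimately have "\<forall>\<^sub>F z in ?F. ereal (a + b) \<le> ereal (h (n + m) z)"
    proof eventually_elim
      case (elim z)
      have "h (n + m) z = h m z + h n ((f ^^ m) z)"
        by (simp add: h_def funpow_add)
      with elim bound[of n "(f ^^ m) z"] show ?case by auto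
    qed
    then show ?thesis unfolding L by (rule Liminf_bounded)
  qed
  show "log_dilation \<eta> p (f ^^ n) + log_dilation \<eta> p (f ^^ m) \<le> log_dilation \<eta> p (f ^^ (n + m))"
    using ereal_add_leI[OF not_MInf not_MInf real_bound] .
qed

end
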